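(* Let $L$ be a finite-dimensional solvable upper semi-modular Leibniz algebra over a field $F$ of characteristic different from two, and let $J=\langle x\in L\mid x^2=0\rangle$ be the subalgebra of $L$ generated by all elements with square zero. Then $J$ is an ideal of $L$.
   Context: A (right) Leibniz algebra over a field $F$ is a vector space $L$ with a bilinear product $[\cdot,\cdot]$ satisfying $[x,[y,z]]=[[x,y],z]-[[x,z],y]$ for all $x,y,z$. Write $x^2=[x,x]$. Ideals are two-sided. $L$ is solvable if $L^{(n)}=0$ for some $n$, where $L^{(0)}=L$, $L^{(k+1)}=[L^{(k)},L^{(k)}]$. For subalgebras (or elements) $U,B$, $\langle U,B\rangle$ denotes the subalgebra they generate. A subalgebra $U$ of $L$ is upper semi-modular in $L$ if $U$ is a maximal subalgebra of $\langle U,B\rangle$ for every subalgebra $B$ of $L$ such that $U\cap B$ is a maximal subalgebra of $B$ (a maximal subalgebra is a maximal proper subalgebra). $L$ is upper semi-modular if every subalgebra of $L$ is upper semi-modular in $L$. *)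

theory Defs
  imports Complex_Main
begin

text \<open>Right Leibniz algebras; the underlying vector space is the whole type \<open>'b\<close>.\<close>

locale leibniz_algebra = vector_space scale
  for scale :: "'a::field \<Rightarrow> 'b::ab_group_add \<Rightarrow> 'b" +
  fixes bracket :: "'b \<Rightarrow> 'b \<Rightarrow> 'b"
  assumes bracket_linear_left: "Vector_Spaces.linear scale scale (\<lambda>x. bracket x y)"
    and bracket_linear_right: "Vector_Spaces.linear scale scale (\<lambda>y. bracket x y)"
    and leibniz_identity:
      "bracket x (bracket y z) = bracket (bracket x y) z - bracket (bracket x z) y"
begin

definition subalgebra :: "'b set \<Rightarrow> bool"
  where "subalgebra U \<longleftrightarrow> subspace U \<and> (\<forall>x\<in>U. \<forall>y\<in>U. bracket x y \<in> U)"

definition ideal :: "'b set \<Rightarrow> bool"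
  where "ideal I \<longleftrightarrow> subspace I \<and> (\<forall>x\<in>I. \<forall>y. bracket x y \<in> I \<and> bracket y x \<in> I)"

definition generated :: "'b set \<Rightarrow> 'b set"
  where "generated S = subalgebra hull S"

definition product :: "'b set \<Rightarrow> 'b set \<Rightarrow> 'b set"
  where "product A B = span {bracket x y | x y. x \<in> A \<and> y \<in> B}"

primrec derived_series :: "nat \<Rightarrow> 'b set"
  where
    "derived_series 0 = UNIV"
  | "derived_series (Suc k) = product (derived_series k) (derived_series k)"

definition solvable :: bool
  where "solvable \<longleftrightarrow> (\<exists>n. derived_series n = {0})"

definition maximal_subalgebra :: "'b set \<Rightarrow> 'b set \<Rightarrow> bool"
  where "maximal_subalgebra M B \<longleftrightarrow>
    subalgebra M \<and> subalgebra B \<and> M \<subset> B \<and>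
    (\<forall>K. subalgebra K \<longrightarrow> M \<subseteq> K \<longrightarrow> K \<subseteq> B \<longrightarrow> K = M \<or> K = B)"

definition upper_semimodular_subalgebra :: "'b set \<Rightarrow> bool"
  where "upper_semimodular_subalgebra U \<longleftrightarrow>
    subalgebra U \<and>
    (\<forall>B. subalgebra B \<longrightarrow> maximal_subalgebra (U \<inter> B) B \<longrightarrow>
      maximal_subalgebra U (generated (U \<union> B)))"

definition upper_semimodular :: bool
  where "upper_semimodular \<longleftrightarrow> (\<forall>U. subalgebra U \<longrightarrow> upper_semimodular_subalgebra U)"

end

end

theory Submission
  imports Defs
begin

text \<open>
  If \<open>K\<close> is an ideal and \<open>x\<^sup>2, y\<^sup>2 \<in> K\<close>, then semi-modularity makes \<open>F x + K\<close> and \<open>F y + K\<close>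
  maximal in the subalgebra they generate; comparing them with the last derived term that is not
  contained in \<open>K\<close> shows that this subalgebra is \<open>F x + F y + K\<close>. With \<open>K = 0\<close> it follows that
  \<open>J\<close> is just the span of the elements with square zero. With \<open>K\<close> the span of all squares, which
  lies in \<open>J\<close> and is annihilated by left multiplications, write \<open>[x, y] = a x + b y + k\<close> for
  \<open>x\<^sup>2 = 0\<close>. Right multiplication by \<open>x\<close> is a scalar \<open>l\<close> on \<open>K\<close>, and if \<open>b \<noteq> 0\<close>, so is right
  multiplication by \<open>y\<close>, say \<open>r\<close>. If \<open>r\<close> or \<open>l\<close> is nonzero, then \<open>y\<close> or \<open>x + y\<close> can be
  corrected by an element of \<open>K\<close> to have square zero; otherwise \<open>2 b y\<^sup>2 = 0\<close>. In each case
  \<open>y \<in> J\<close>.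
\<close>

context leibniz_algebra
begin

section \<open>Bilinearity, subalgebras and spans\<close>

lemma bracket_simps [simp]:
  "bracket (x + y) z = bracket x z + bracket y z"
  "bracket z (x + y) = bracket z x + bracket z y"
  "bracket (x - y) z = bracket x z - bracket y z"
  "bracket z (x - y) = bracket z x - bracket z y"
  "bracket (scale c x) z = scale c (bracket x z)"
  "bracket z (scale c x) = scale c (bracket z x)"
  "bracket (- x) z = - bracket x z"
  "bracket z (- x) = - bracket z x"
  "bracket 0 z = 0"
  "bracket z 0 = 0"
proof -
  interpret l: module_hom scale scale "\<lambda>x. bracket x z"
    using bracket_linear_left by (simp add: linear_iff_module_hom)
  interpret r: module_hom scale scale "bracket z"
    using bracket_linear_right by (simp add: linear_iff_module_hom)
  show "bracket (x + y) z = bracket x z + bracket y z"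
    "bracket z (x + y) = bracket z x + bracket z y"
    "bracket (x - y) z = bracket x z - bracket y z"
    "bracket z (x - y) = bracket z x - bracket z y"
    "bracket (scale c x) z = scale c (bracket x z)"
    "bracket z (scale c x) = scale c (bracket z x)"
    "bracket (- x) z = - bracket x z"
    "bracket z (- x) = - bracket z x"
    "bracket 0 z = 0"
    "bracket z 0 = 0"
    by (rule l.add r.add l.diff r.diff l.scale r.scale l.neg r.neg l.zero r.zero)+
qed

lemma subalgebraI:
  "subspace U \<Longrightarrow> (\<And>x y. x \<in> U \<Longrightarrow> y \<in> U \<Longrightarrow> bracket x y \<in> U) \<Longrightarrow> subalgebra U"
  by (simp add: subalgebra_def)

lemma subalgebra_subspace: "subalgebra U \<Longrightarrow> subspace U"
  by (simp add: subalgebra_def)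

lemma subalgebra_bracket: "subalgebra U \<Longrightarrow> x \<in> U \<Longrightarrow> y \<in> U \<Longrightarrow> bracket x y \<in> U"
  by (simp add: subalgebra_def)

lemma idealD:
  assumes "ideal I"
  shows "subspace I" "x \<in> I \<Longrightarrow> bracket x y \<in> I" "x \<in> I \<Longrightarrow> bracket y x \<in> I" "subalgebra I"
  using assms by (auto simp: ideal_def subalgebra_def)

lemma subalgebra_Inter: "(\<And>U. U \<in> \<U> \<Longrightarrow> subalgebra U) \<Longrightarrow> subalgebra (\<Inter>\<U>)"
  by (auto simp: subalgebra_def intro!: subspace_Inter)

lemma subalgebra_generated: "subalgebra (generated S)"
  unfolding generated_def by (rule hull_in) (blast intro: subalgebra_Inter)

lemma generated_superset: "S \<subseteq> generated S"
  unfolding generated_def by (rule hull_subset)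

lemma generated_minimal: "S \<subseteq> U \<Longrightarrow> subalgebra U \<Longrightarrow> generated S \<subseteq> U"
  unfolding generated_def by (rule hull_minimal)

text \<open>Bilinearity, applied by span induction in one argument and then in the other. Taking a
  singleton for \<open>S\<close> or \<open>T\<close> handles multiplication by one fixed
  element.\<close>

lemma bracket_span:
  assumes "x \<in> span S" "y \<in> span T" "subspace U"
    and "\<And>s t. s \<in> S \<Longrightarrow> t \<in> T \<Longrightarrow> bracket s t \<in> U"
  shows "bracket x y \<in> U"
proof -
  have "bracket s y \<in> U" if "s \<in> S" for s
    using assms(2)
    by (induction rule: span_induct_alt)
      (use assms(3,4) that in \<open>auto intro: subspace_0 subspace_add subspace_scale\<close>)
  with assms(1) show ?thesis
    by (induction rule: span_induct_alt)
      (use assms(3) in \<open>auto intro: subspace_0 subspace_add subspace_scale\<close>)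
qed

lemma subalgebra_span:
  assumes "\<And>s t. s \<in> S \<Longrightarrow> t \<in> S \<Longrightarrow> bracket s t \<in> span S"
  shows "subalgebra (span S)"
  by (rule subalgebraI) (auto intro: bracket_span assms)

lemma in_span_insert_iff:
  assumes "subspace K"
  shows "a \<in> span (insert b K) \<longleftrightarrow> (\<exists>c. a - scale c b \<in> K)"
  using assms by (metis span_breakdown_eq span_eq_iff)

lemma in_span_insert2_iff:
  assumes "subspace K"
  shows "z \<in> span (insert x (insert y K)) \<longleftrightarrow> (\<exists>a b. z - scale a x - scale b y \<in> K)"
  by (subst span_breakdown_eq) (simp add: in_span_insert_iff[OF assms])

lemma span_insert_exchange:
  assumes "subspace K" "y \<in> span (insert x K)" "y \<notin> K"
  shows "x \<in> span (insert y K)"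
  using assms by (metis in_span_insert span_eq_iff)

section \<open>Ideals and the derived series\<close>

text \<open>The Leibniz identity moves an outside factor \<open>c\<close> onto \<open>a\<close> or
  \<open>b\<close>: both \<open>[[a, b], c]\<close> and \<open>[c, [a, b]]\<close> unfold into
  products of two elements of \<open>I\<close>.\<close>

lemma ideal_product_self:
  assumes I: "ideal I"
  shows "ideal (product I I)"
proof -
  let ?P = "{bracket x y | x y. x \<in> I \<and> y \<in> I}"
  have base: "bracket x y \<in> span ?P" if "x \<in> I" "y \<in> I" for x y
    using that by (blast intro: span_base)
  have "bracket z c \<in> span ?P \<and> bracket c z \<in> span ?P" if z: "z \<in> span ?P" for z c
  proof
    have c: "c \<in> span {c}"
      by (simp add: span_base)
    show "bracket z c \<in> span ?P"
    proof (rule bracket_span[OF z c subspace_span])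
      fix s t assume "s \<in> ?P" "t \<in> {c}"
      then obtain a b where ab: "a \<in> I" "b \<in> I" "s = bracket a b" "t = c"
        by blast
      have "bracket s t = bracket a (bracket b c) + bracket (bracket a c) b"
        using ab by (simp add: leibniz_identity)
      then show "bracket s t \<in> span ?P"
        using ab I by (auto intro!: span_add base intro: idealD)
    qed
    show "bracket c z \<in> span ?P"
    proof (rule bracket_span[OF c z subspace_span])
      fix t s assume "t \<in> {c}" "s \<in> ?P"
      then obtain a b where ab: "a \<in> I" "b \<in> I" "s = bracket a b" "t = c"
        by blast
      have "bracket t s = bracket (bracket c a) b - bracket (bracket c b) a"
        using ab by (simp add: leibniz_identity)
      then show "bracket t s \<in> span ?P"
        using ab I by (auto intro!: span_diff base intro: idealD)
    qed
  qed
  then show ?thesis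
    by (simp add: ideal_def product_def)
qed

lemma ideal_derived_series: "ideal (derived_series k)"
proof (induction k)
  case 0
  show ?case
    by (simp add: ideal_def)
qed (simp add: ideal_product_self)

section \<open>Semi-modularity for one-dimensional extensions of an ideal\<close>

lemma subalgebra_span_insert_ideal:
  assumes K: "ideal K" and x: "bracket x x \<in> K"
  shows "subalgebra (span (insert x K))"
  by (rule subalgebra_span) (use K x in \<open>auto intro: span_base idealD\<close>)

text \<open>Modulo \<open>K\<close> the two spans are distinct lines. They therefore meet in
  \<open>K\<close>, which is maximal in the second one, and semi-modularity of the first
  applies.\<close>

lemma maximal_subalgebra_span_insert:
  assumes "upper_semimodular" and K: "ideal K"
    and x: "bracket x x \<in> K" and y: "bracket y y \<in> K"
    and xy: "x \<notin> span (insert y K)" and yK: "y \<notin> K"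
  shows "maximal_subalgebra (span (insert x K))
    (generated (span (insert x K) \<union> span (insert y K)))"
proof -
  let ?X = "span (insert x K)" and ?Y = "span (insert y K)"
  note sK = idealD(1)[OF K]
  have "?X \<inter> ?Y \<subseteq> K"
  proof
    fix z assume z: "z \<in> ?X \<inter> ?Y"
    show "z \<in> K"
    proof (rule ccontr)
      assume "z \<notin> K"
      then have "x \<in> span (insert z K)"
        using z span_insert_exchange[OF sK] by blast
      moreover have "span (insert z K) \<subseteq> ?Y"
        by (rule span_minimal) (use z in \<open>auto intro: span_base\<close>)
      ultimately show False
        using xy by blast
    qed
  qed
  then have int: "?X \<inter> ?Y = K"
    by (auto intro: span_base)
  have "maximal_subalgebra K ?Y"
    unfolding maximal_subalgebra_def
  proof (intro conjI allI impI)
    show "K \<subset> ?Y"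
      using yK by (auto intro: span_base)
    fix T assume T: "subalgebra T" "K \<subseteq> T" "T \<subseteq> ?Y"
    show "T = K \<or> T = ?Y"
    proof (rule disjCI)
      assume "T \<noteq> ?Y"
      have "z \<in> K" if "z \<in> T" for z
      proof (rule ccontr)
        assume "z \<notin> K"
        then have "y \<in> span (insert z K)"
          using that T span_insert_exchange[OF sK] by blast
        moreover have "span (insert z K) \<subseteq> T"
          by (rule span_minimal) (use that T in \<open>auto simp: subalgebra_subspace\<close>)
        ultimately have "?Y \<subseteq> T"
          by (intro span_minimal) (use T in \<open>auto simp: subalgebra_subspace\<close>)
        with T \<open>T \<noteq> ?Y\<close> show False
          by blast
      qed
      with T show "T = K"
        by blast
    qed
  qed (use K y in \<open>auto intro: idealD subalgebra_span_insert_ideal\<close>)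
  then show ?thesis
    using assms(1) int subalgebra_span_insert_ideal[OF K x] subalgebra_span_insert_ideal[OF K y]
    unfolding upper_semimodular_def upper_semimodular_subalgebra_def by auto
qed

text \<open>Every \<open>a\<close> in \<open>N\<close> outside \<open>K\<close> has its square in
  \<open>K\<close> and can replace \<open>y\<close> as a partner of \<open>x\<close>. Maximality of
  \<open>F a + K\<close> collapses \<open>N\<close> to \<open>F a + K\<close>; maximality of
  \<open>F x + K\<close> then makes \<open>F x + F a + K\<close> the whole generated subalgebra.
  That is a plane modulo \<open>K\<close>, hence also spanned by \<open>x\<close> and
  \<open>y\<close>.\<close>

lemma generated_subset_span_of_abelian_factor:
  assumes usm: "upper_semimodular" and K: "ideal K"
    and x: "bracket x x \<in> K" and y: "bracket y y \<in> K"
    and xy: "x \<notin> span (insert y K)" and yx: "y \<notin> span (insert x K)"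
    and N: "subspace N" "K \<subset> N"
    and NM: "N \<subseteq> generated (span (insert x K) \<union> span (insert y K))"
    and Nx: "\<And>a. a \<in> N \<Longrightarrow> bracket a x \<in> N \<and> bracket x a \<in> N"
    and NN: "\<And>a b. a \<in> N \<Longrightarrow> b \<in> N \<Longrightarrow> bracket a b \<in> K"
    and xN: "x \<notin> N"
  shows "generated (span (insert x K) \<union> span (insert y K)) \<subseteq> span (insert x (insert y K))"
proof -
  let ?M = "generated (span (insert x K) \<union> span (insert y K))"
  note sK = idealD(1)[OF K]
  have yK: "y \<notin> K"
    using yx by (auto intro: span_base)
  obtain a where a: "a \<in> N" "a \<notin> K"
    using N by blast
  have Xmax: "maximal_subalgebra (span (insert x K)) ?M"
    by (rule maximal_subalgebra_span_insert[OF usm K x y xy yK])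
  have aa: "bracket a a \<in> K"
    using a NN by blast
  have AN: "span (insert a K) \<subseteq> N"
    by (rule span_minimal) (use a N in auto)
  have xa: "x \<notin> span (insert a K)"
    using AN xN by blast
  then have ax: "a \<notin> span (insert x K)"
    using span_insert_exchange[OF sK] a by blast
  have sM: "subalgebra ?M"
    by (rule subalgebra_generated)
  have XM: "span (insert x K) \<subseteq> ?M"
    using generated_superset by blast
  \<comment> \<open>Replacing \<open>y\<close> by \<open>a\<close> does not change the generated
    subalgebra: \<open>?G\<close> lies in \<open>?M\<close> and properly contains the maximal
    \<open>F x + K\<close>.\<close>
  let ?G = "generated (span (insert a K) \<union> span (insert x K))"
  have "?G \<subseteq> ?M"
    by (rule generated_minimal) (use AN NM XM sM in auto)
  moreover have "a \<in> ?G" "span (insert x K) \<subseteq> ?G"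
    using generated_superset[of "span (insert a K) \<union> span (insert x K)"] by (auto intro: span_base)
  ultimately have G: "?G = ?M"
    using Xmax ax subalgebra_generated unfolding maximal_subalgebra_def by blast
  have "x \<notin> K"
    using xy by (auto intro: span_base)
  then have Amax: "maximal_subalgebra (span (insert a K)) ?M"
    using maximal_subalgebra_span_insert[OF usm K aa x ax] G by simp
  have "subalgebra N"
    using N NN by (blast intro: subalgebraI)
  moreover have "N \<noteq> ?M"
    using xN XM by (auto intro: span_base)
  ultimately have NA: "N = span (insert a K)"
    using Amax AN NM unfolding maximal_subalgebra_def by blast
  let ?T = "span (insert x (insert a K))"
  have NT: "N \<subseteq> ?T"
    unfolding NA by (intro span_mono) auto
  have "subalgebra ?T"
  proof (rule subalgebra_span)
    fix s t assume st: "s \<in> insert x (insert a K)" "t \<in> insert x (insert a K)"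
    have KN: "K \<subseteq> N"
      using N by blast
    \<comment> \<open>All products of generators fall into \<open>N = F a + K\<close>:
      \<open>x\<close> normalizes \<open>N\<close>, and the remaining products lie in
      \<open>K\<close>.\<close>
    have "bracket s t \<in> N"
      using st a x Nx[of a] NN[of a a] KN K by (auto dest: idealD(2,3)[OF K])
    then show "bracket s t \<in> ?T"
      using NT by blast
  qed
  moreover have "?T \<subseteq> ?M"
    by (rule span_minimal) (use a N NM XM sM in \<open>auto intro: span_base subalgebra_subspace\<close>)
  moreover have "span (insert x K) \<subseteq> ?T"
    by (rule span_mono) auto
  moreover have "a \<in> ?T"
    by (simp add: span_base)
  ultimately have T: "?T = ?M"
    using Xmax ax unfolding maximal_subalgebra_def by blast
  have "y \<in> ?M"
    using generated_superset[of "span (insert x K) \<union> span (insert y K)"] by (auto intro: span_base)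
  \<comment> \<open>Subtracting the \<open>x\<close>-component of \<open>y\<close> leaves an element
    of \<open>F a + K\<close> outside \<open>K\<close>; exchanging it with \<open>a\<close>
    expresses \<open>a\<close> through \<open>x\<close>, \<open>y\<close> and
    \<open>K\<close>.\<close>
  then obtain c where "y - scale c x \<in> span (insert a K)"
    unfolding T[symmetric] by (auto simp: span_breakdown_eq)
  moreover have "y - scale c x \<notin> K"
    using yx in_span_insert_iff[OF sK] by blast
  ultimately have "a \<in> span (insert (y - scale c x) K)"
    by (rule span_insert_exchange[OF sK])
  moreover have "span (insert (y - scale c x) K) \<subseteq> span (insert x (insert y K))"
  proof (rule span_minimal)
    have "y - scale c x \<in> span (insert x (insert y K))"
      by (intro span_diff span_scale span_base) simp_all
    moreover have "K \<subseteq> span (insert x (insert y K))"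
      by (auto intro: span_base)
    ultimately show "insert (y - scale c x) K \<subseteq> span (insert x (insert y K))"
      by simp
  qed simp
  ultimately have "a \<in> span (insert x (insert y K))"
    by blast
  moreover have "insert x K \<subseteq> span (insert x (insert y K))"
    by (auto intro: span_base)
  ultimately have "?T \<subseteq> span (insert x (insert y K))"
    by (intro span_minimal) auto
  then show ?thesis
    using T by simp
qed

text \<open>If \<open>x\<close> and \<open>y\<close> are dependent modulo \<open>K\<close>, then
  \<open>[x, y]\<close> lies in \<open>K\<close>. Otherwise solvability supplies an \<open>N\<close>
  for the preceding lemma, and the two generators may be interchanged there, so it suffices that one
  of them lies outside \<open>N\<close>.\<close>

lemma bracket_in_span_insert:
  assumes solv: "solvable" and usm: "upper_semimodular" and K: "ideal K"
    and x: "bracket x x \<in> K" and y: "bracket y y \<in> K"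
  shows "bracket x y \<in> span (insert x (insert y K))"
proof -
  note sK = idealD(1)[OF K]
  let ?M = "generated (span (insert x K) \<union> span (insert y K))"
  have XM: "span (insert x K) \<subseteq> ?M" and YM: "span (insert y K) \<subseteq> ?M"
    using generated_superset by blast+
  then have xM: "x \<in> ?M" and yM: "y \<in> ?M" and KM: "K \<subseteq> ?M"
    by (auto intro: span_base)
  have sM: "subalgebra ?M"
    by (rule subalgebra_generated)
  have KS: "K \<subseteq> span (insert x (insert y K))"
    by (auto intro: span_base)
  consider "x \<in> span (insert y K)" | "y \<in> span (insert x K)"
    | "x \<notin> span (insert y K)" "y \<notin> span (insert x K)"
    by blast
  then show ?thesis
  proof cases
    case 1
    have "bracket x y \<in> K"
      by (rule bracket_span[OF 1 span_base[of y "{y}"] sK]) (use y in \<open>auto intro: idealD[OF K]\<close>)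
    with KS show ?thesis by blast
  next
    case 2
    have "bracket x y \<in> K"
      by (rule bracket_span[OF span_base[of x "{x}"] 2 sK]) (use x in \<open>auto intro: idealD[OF K]\<close>)
    with KS show ?thesis by blast
  next
    case 3
    obtain n where "derived_series n = {0}"
      using solv by (auto simp: solvable_def)
    then have "?M \<inter> derived_series n \<subseteq> K"
      using subspace_0[OF sK] by auto
    moreover have "\<not> ?M \<inter> derived_series 0 \<subseteq> K"
      using 3 xM by (auto intro: span_base)
    \<comment> \<open>The last derived term whose intersection with \<open>?M\<close> is not inside
      \<open>K\<close>. If there were none, downward induction from \<open>n\<close> would carry the
      inclusion to index 0, where \<open>x\<close> violates it.\<close>
    ultimately obtain k where k: "\<not> ?M \<inter> derived_series k \<subseteq> K"
      "?M \<inter> derived_series (Suc k) \<subseteq> K"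
      by (metis inc_induct[where P = "\<lambda>k. ?M \<inter> derived_series k \<subseteq> K"] zero_le)
    define D where "D = ?M \<inter> derived_series k"
    have sD: "subspace D"
      unfolding D_def by (intro subspace_inter subalgebra_subspace sM idealD ideal_derived_series)
    have MD: "bracket d m \<in> D \<and> bracket m d \<in> D" if "d \<in> D" "m \<in> ?M" for d m
      using that idealD[OF ideal_derived_series[of k]] subalgebra_bracket[OF sM]
      unfolding D_def by blast
    have DD: "bracket d e \<in> K" if "d \<in> D" "e \<in> D" for d e
    proof -
      have "bracket d e \<in> derived_series (Suc k)"
        using that by (auto simp: D_def product_def intro: span_base)
      moreover have "bracket d e \<in> ?M"
        using that subalgebra_bracket[OF sM] by (auto simp: D_def)
      ultimately show ?thesis
        using k by blast
    qed
    \<comment> \<open>\<open>D\<close> need not contain \<open>K\<close>, so \<open>K\<close> is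
      added; \<open>N\<close> is still stable under multiplication by \<open>?M\<close>, and its
      products still lie in \<open>K\<close>.\<close>
    define N where "N = span (D \<union> K)"
    have sN: "subspace N"
      by (simp add: N_def)
    have KN: "K \<subset> N"
      using k(1) by (auto simp: N_def D_def intro: span_base)
    have NM: "N \<subseteq> ?M"
      unfolding N_def
      by (rule span_minimal) (use KM sM in \<open>auto simp: D_def intro: subalgebra_subspace\<close>)
    have NN: "bracket a b \<in> K" if "a \<in> N" "b \<in> N" for a b
      by (rule bracket_span[OF that[unfolded N_def] sK]) (auto intro: DD idealD[OF K])
    have Nm: "bracket a m \<in> N \<and> bracket m a \<in> N" if "a \<in> N" "m \<in> ?M" for a m
    proof
      have m: "m \<in> span {m}"
        by (simp add: span_base)
      note a = that(1)[unfolded N_def]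
      show "bracket a m \<in> N"
        by (rule bracket_span[OF a m sN])
          (use that MD in \<open>auto simp: N_def intro: span_base idealD[OF K]\<close>)
      show "bracket m a \<in> N"
        by (rule bracket_span[OF m a sN])
          (use that MD in \<open>auto simp: N_def intro: span_base idealD[OF K]\<close>)
    qed
    consider "x \<in> N" "y \<in> N" | "x \<notin> N" | "y \<notin> N"
      by blast
    then show ?thesis
    proof cases
      case 1
      then show ?thesis
        using NN KS by blast
    next
      case 2
      have "?M \<subseteq> span (insert x (insert y K))"
        by (rule generated_subset_span_of_abelian_factor[OF usm K x y 3 sN KN NM _ NN 2])
          (use Nm xM in auto)
      then show ?thesis
        using subalgebra_bracket[OF sM xM yM] by blast
    next
      case n: 3
      have "?M \<subseteq> span (insert y (insert x K))"
        unfolding Un_commute[of "span (insert x K)"]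
        by (rule generated_subset_span_of_abelian_factor[OF usm K y x 3(2,1) sN KN _ _ NN n])
          (use Nm yM NM in \<open>auto simp: Un_commute\<close>)
      then show ?thesis
        using subalgebra_bracket[OF sM xM yM] by (auto simp: insert_commute)
    qed
  qed
qed

section \<open>Elements with square zero and the span of all squares\<close>

lemma ideal_zero: "ideal {0}"
  by (simp add: ideal_def)

lemma generated_null_squares:
  assumes "solvable" "upper_semimodular"
  shows "generated {x. bracket x x = 0} = span {x. bracket x x = 0}"
proof -
  let ?S = "{x. bracket x x = 0}"
  have "bracket x y \<in> span ?S" if "x \<in> ?S" "y \<in> ?S" for x y
  proof -
    have "bracket x y \<in> span (insert x (insert y {0}))"
      by (rule bracket_in_span_insert[OF assms ideal_zero]) (use that in auto)
    also have "\<dots> \<subseteq> span ?S"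
      by (rule span_mono) (use that in auto)
    finally show ?thesis .
  qed
  then have "subalgebra (span ?S)"
    by (rule subalgebra_span)
  then have "generated ?S \<subseteq> span ?S"
    by (intro generated_minimal) (auto intro: span_base)
  moreover have "span ?S \<subseteq> generated ?S"
    by (intro span_minimal generated_superset subalgebra_subspace subalgebra_generated)
  ultimately show ?thesis
    by blast
qed

text \<open>This is the ideal whose quotient is a Lie algebra; a plain span is enough, as the ideal
  property is proved below.\<close>

definition leibniz_kernel :: "'b set"
  where "leibniz_kernel = span (range (\<lambda>x. bracket x x))"

lemma square_in_leibniz_kernel: "bracket x x \<in> leibniz_kernel"
  by (auto simp: leibniz_kernel_def intro: span_base)

lemma symmetrized_bracket_in_leibniz_kernel:
  "bracket x y + bracket y x \<in> leibniz_kernel"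
proof -
  have "bracket x y + bracket y x = bracket (x + y) (x + y) - bracket x x - bracket y y"
    by simp
  also have "\<dots> \<in> leibniz_kernel"
    unfolding leibniz_kernel_def by (intro span_diff span_base rangeI)
  finally show ?thesis .
qed

text \<open>For equal inner factors the two terms of the Leibniz identity cancel.\<close>

lemma bracket_leibniz_kernel:
  assumes "v \<in> leibniz_kernel"
  shows "bracket x v = 0"
  using assms unfolding leibniz_kernel_def
  by (induction rule: span_induct_alt) (auto simp: leibniz_identity)

lemma ideal_leibniz_kernel: "ideal leibniz_kernel"
proof -
  have "bracket v x \<in> leibniz_kernel" if "v \<in> leibniz_kernel" for v x
    using symmetrized_bracket_in_leibniz_kernel[of x v] bracket_leibniz_kernel[OF that]
    by simp
  then show ?thesis
    by (auto simp: ideal_def bracket_leibniz_kernel) (auto simp: leibniz_kernel_def span_zero)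
qed

text \<open>Comparing the eigenvalues at \<open>u\<close>, \<open>v\<close> and \<open>u + v\<close>
  either makes them equal or makes \<open>v\<close> a multiple of \<open>u\<close>, where
  homogeneity gives the same scalar.\<close>

lemma eigenvectors_common_eigenvalue:
  assumes K: "subspace K"
    and add: "\<And>u v. f (u + v) = f u + f v"
    and homogeneous: "\<And>c v. f (scale c v) = scale c (f v)"
    and eig: "\<And>v. v \<in> K \<Longrightarrow> \<exists>c. f v = scale c v"
  obtains l where "\<And>v. v \<in> K \<Longrightarrow> f v = scale l v"
proof (cases "K \<subseteq> {0}")
  case True
  with eig that show ?thesis
    by (metis scale_zero_right singletonD subsetD)
next
  case False
  then obtain u where u: "u \<in> K" "u \<noteq> 0"
    by blast
  then obtain l where l: "f u = scale l u"
    using eig by blast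
  have "f v = scale l v" if v: "v \<in> K" for v
  proof -
    obtain m where m: "f v = scale m v"
      using eig v by blast
    obtain c where c: "f (u + v) = scale c (u + v)"
      using eig u v subspace_add[OF K] by blast
    have "scale l u + scale m v = scale c u + scale c v"
      using c by (simp add: add l m scale_right_distrib)
    then have eq: "scale (l - c) u = scale (c - m) v"
      by (simp add: algebra_simps)
    show ?thesis
    proof (cases "c = m")
      case True
      with eq u m show ?thesis
        by auto
    next
      case False
      then have "v = scale (inverse (c - m)) (scale (c - m) v)"
        by simp
      also have "\<dots> = scale (inverse (c - m) * (l - c)) u"
        by (simp flip: eq)
      finally obtain d where d: "v = scale d u"
        by blast
      then show ?thesis
        by (simp add: homogeneous l mult.commute)
    qed
  qed
  then show ?thesis
    by (rule that)
qed

lemma leibniz_kernel_subset_span_null_squares: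
  "leibniz_kernel \<subseteq> span {x. bracket x x = 0}"
  unfolding leibniz_kernel_def
  by (rule span_mono) (auto simp: bracket_leibniz_kernel square_in_leibniz_kernel)

section \<open>Multiplying an element with square zero by an arbitrary element\<close>

lemma bracket_null_square_in_span:
  assumes char: "(2::'a) \<noteq> 0" and solv: "solvable" and usm: "upper_semimodular"
    and x: "bracket x x = 0"
  shows "bracket x y \<in> span {x. bracket x x = 0}"
proof -
  let ?J = "span {x. bracket x x = 0}" and ?K = leibniz_kernel
  note K = ideal_leibniz_kernel
  note sK = idealD(1)[OF K]
  note KJ = leibniz_kernel_subset_span_null_squares
  note [simp] = x bracket_leibniz_kernel
  have xJ: "x \<in> ?J"
    by (simp add: span_base)
  \<comment> \<open>\<open>?J\<close> is a subalgebra containing \<open>x\<close>, so it is enough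
    to place \<open>y\<close> itself in \<open>?J\<close>.\<close>
  have closed: "bracket x y \<in> ?J" if "y \<in> ?J"
    using that generated_null_squares[OF solv usm] xJ subalgebra_generated subalgebra_bracket
    by metis
  show ?thesis
  proof (cases "x \<in> ?K")
    case True
    then show ?thesis
      using idealD(2)[OF K] KJ by blast
  next
    case xK: False
    obtain a b where ab: "bracket x y - scale a x - scale b y \<in> ?K"
      using bracket_in_span_insert[OF solv usm K square_in_leibniz_kernel square_in_leibniz_kernel]
      unfolding in_span_insert2_iff[OF sK] by blast
    define k where "k = bracket x y - scale a x - scale b y"
    have kK [simp]: "k \<in> ?K"
      using ab by (simp add: k_def)
    have xy: "bracket x y = scale a x + scale b y + k"
      by (simp add: k_def)
    show ?thesis
    proof (cases "b = 0")
      case True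
      then show ?thesis
        using xy xJ kK KJ by (auto intro!: span_add span_scale)
    next
      case b: False
      \<comment> \<open>Here \<open>v\<close> and \<open>x\<close> both have square zero, so the
        bracket lemma over the zero ideal gives \<open>[v, x] = c v + d x\<close>. As
        \<open>?K\<close> is an ideal without \<open>x\<close>, \<open>d = 0\<close>.\<close>
      have "\<exists>c. bracket v x = scale c v" if v: "v \<in> ?K" for v
      proof -
        have "bracket v x \<in> span (insert v (insert x {0}))"
          by (rule bracket_in_span_insert[OF solv usm ideal_zero]) (use v in auto)
        then obtain c d where cd: "bracket v x = scale c v + scale d x"
          by (auto simp: in_span_insert2_iff algebra_simps)
        then have "scale d x = bracket v x - scale c v"
          by simp
        also have "\<dots> \<in> ?K"
          using v by (intro subspace_diff[OF sK] subspace_scale[OF sK] idealD(2)[OF K])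
        finally have "scale (inverse d) (scale d x) \<in> ?K"
          by (rule subspace_scale[OF sK])
        then have "d = 0"
          using xK by (cases "d = 0") auto
        with cd show ?thesis
          by auto
      qed
      then obtain l where l: "\<And>v. v \<in> ?K \<Longrightarrow> bracket v x = scale l v"
        using eigenvectors_common_eigenvalue[OF sK, of "\<lambda>v. bracket v x"] by auto
      \<comment> \<open>Right multiplication by \<open>x\<close> is the scalar \<open>l\<close> on
        both \<open>v\<close> and \<open>[v, y]\<close>, so the Leibniz identity gives
        \<open>[v, [x, y]] = 0\<close>. Inserting \<open>[x, y] = a x + b y + k\<close> yields
        \<open>a l v + b [v, y] = 0\<close>, which is solved for \<open>[v, y]\<close>.\<close>
      define r where "r = - (a * l) / b"
      have r: "bracket v y = scale r v" if v: "v \<in> ?K" for v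
      proof -
        have vy: "bracket v y \<in> ?K"
          using idealD(2)[OF K v] .
        have "bracket v (bracket x y) = 0"
          using l[OF v] l[OF vy] by (simp add: leibniz_identity)
        then have "scale b (bracket v y) = scale (- (a * l)) v"
          using l[OF v] v by (simp add: xy add_eq_0_iff2)
        then have "scale (inverse b) (scale b (bracket v y)) = scale (inverse b * (- (a * l))) v"
          by simp
        then show ?thesis
          using b by (simp add: r_def field_simps)
      qed
      define z where "z = bracket y y"
      have zK [simp]: "z \<in> ?K"
        by (simp add: z_def square_in_leibniz_kernel)
      define s where "s = bracket x y + bracket y x"
      have s_in_K [simp]: "s \<in> ?K"
        by (simp add: s_def symmetrized_bracket_in_leibniz_kernel)
      have yx: "bracket y x = s - bracket x y"
        by (simp add: s_def)
      have "y \<in> ?J"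
      proof (cases "r = 0")
        case False
        \<comment> \<open>Since \<open>z\<close> is killed by left multiplications, the square of
          \<open>y + t z\<close> is \<open>z + t r z\<close>; the choice \<open>t = -1 / r\<close>
          makes it vanish.\<close>
        let ?w = "y - scale (inverse r) z"
        have "bracket ?w ?w = 0"
          using False by (simp add: r flip: z_def)
        then have "?w \<in> ?J"
          by (simp add: span_base)
        moreover have "scale (inverse r) z \<in> ?J"
          using KJ zK by (blast intro: span_scale)
        ultimately have "?w + scale (inverse r) z \<in> ?J"
          by (rule span_add)
        then show ?thesis
          by simp
      next
        case r0: True
        show ?thesis
        proof (cases "l = 0")
          case False
          \<comment> \<open>The square of \<open>x + y\<close> is \<open>z + s\<close>. Adding
            \<open>v\<close> changes it by \<open>[v, x] + [v, y] = l v\<close>, because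
            \<open>r = 0\<close>.\<close>
          define v where "v = - scale (inverse l) (z + s)"
          have v [simp]: "v \<in> ?K"
            unfolding v_def by (intro subspace_neg[OF sK] subspace_scale[OF sK] subspace_add[OF sK]) auto
          let ?w = "x + y + v"
          have "bracket ?w ?w = z + s + bracket v x + bracket v y"
            by (simp add: z_def s_def algebra_simps)
          also have "\<dots> = 0"
            using l[OF v] r[OF v] r0 False by (simp add: v_def)
          finally have "?w \<in> ?J"
            by (simp add: span_base)
          then have "?w - x - v \<in> ?J"
            using v KJ xJ by (blast intro: span_diff)
          then show ?thesis
            by simp
        next
          case True
          \<comment> \<open>This is the Leibniz identity with \<open>[x, x] = 0\<close>. Expanding
            \<open>[x, y]\<close> turns the left side into \<open>b ([x, y] + [y, x]) = b s\<close>,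
            because \<open>[k, x] = 0\<close>.\<close>
          have "bracket x (bracket x y) + bracket (bracket x y) x = 0"
            by (simp add: leibniz_identity)
          then have "scale b s = 0"
            using l[OF kK] True by (simp add: xy yx scale_right_diff_distrib)
          then have "s = 0"
            using b by simp
          have leib: "bracket y (bracket x y) = bracket (bracket y x) y - bracket z x"
            by (simp add: leibniz_identity z_def)
          \<comment> \<open>With \<open>[y, x] = - [x, y]\<close>, the left side of
            \<open>leib\<close> is \<open>b z - a [x, y]\<close> and the right side is
            \<open>- a [x, y] - b z\<close>. Characteristic different from two then forces
            \<open>z = 0\<close>.\<close>
          have "scale (2 * b) z = 0"
          proof -
            have "bracket y (bracket x y) = bracket y (scale a x + scale b y + k)"
              by (simp only: xy)
            also have "\<dots> = scale b z - scale a (bracket x y)"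
              by (simp add: yx \<open>s = 0\<close> flip: z_def)
            finally have "bracket y (bracket x y) = scale b z - scale a (bracket x y)" .
            moreover have "bracket (bracket x y) y = bracket (scale a x + scale b y + k) y"
              by (simp only: xy)
            then have "bracket (bracket x y) y = scale a (bracket x y) + scale b z"
              using r[OF kK] r0 by (simp flip: z_def)
            moreover have "bracket z x = 0"
              using l[OF zK] True by simp
            ultimately have "- scale b z = scale b z"
              using leib by (simp add: yx \<open>s = 0\<close> algebra_simps)
            then have "scale b z + scale b z = 0"
              by (metis add.right_inverse)
            then show ?thesis
              by (simp only: mult_2 scale_left_distrib)
          qed
          then have "bracket y y = 0"
            using b char by (simp add: z_def)
          then show ?thesis
            by (simp add: span_base)
        qed
      qed
      then show ?thesis
        by (rule closed)
    qed
  qed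
qed

section \<open>The ideal property and the characteristic\<close>

text \<open>The preceding lemma covers products with the null square on the left. Reversing the
  factors only changes the sign modulo \<open>leibniz_kernel\<close>, which lies in the span, and
  bilinearity extends both cases from null squares to their span.\<close>

theorem ideal_generated_null_squares:
  assumes "(2::'a) \<noteq> 0" "solvable" "upper_semimodular"
  shows "ideal (generated {x. bracket x x = 0})"
  unfolding generated_null_squares[OF assms(2,3)]
proof -
  let ?S = "{x. bracket x x = 0}"
  have left: "bracket s y \<in> span ?S" if "s \<in> ?S" for s y
    using bracket_null_square_in_span[OF assms] that by blast
  have right: "bracket y s \<in> span ?S" if "s \<in> ?S" for s y
  proof -
    have "bracket y s = (bracket s y + bracket y s) - bracket s y"
      by simp
    also have "\<dots> \<in> span ?S"
      using left[OF that] symmetrized_bracket_in_leibniz_kernel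
        leibniz_kernel_subset_span_null_squares
      by (blast intro: span_diff)
    finally show ?thesis .
  qed
  have "bracket x y \<in> span ?S \<and> bracket y x \<in> span ?S" if x: "x \<in> span ?S" for x y
    using bracket_span[OF x span_base[of y "{y}"] subspace_span]
      bracket_span[OF span_base[of y "{y}"] x subspace_span] left right
    by auto
  then show "ideal (span ?S)"
    by (simp add: ideal_def)
qed

end

theorem theorem2p9:
  fixes scale :: "'a::field \<Rightarrow> 'b::ab_group_add \<Rightarrow> 'b"
    and bracket :: "'b \<Rightarrow> 'b \<Rightarrow> 'b"
  assumes "leibniz_algebra scale bracket"
    and "\<exists>Basis. finite_dimensional_vector_space scale Basis"
    and "CHAR('a) \<noteq> 2"
    and "leibniz_algebra.solvable scale bracket"
    and "leibniz_algebra.upper_semimodular scale bracket"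
  shows "leibniz_algebra.ideal scale bracket
    (leibniz_algebra.generated scale bracket {x. bracket x x = 0})"
proof -
  \<comment> \<open>If \<open>2 = 0\<close>, the characteristic divides 2; it is not 1 in a field
    and not 2 by hypothesis.\<close>
  have "(2::'a) \<noteq> 0"
  proof
    assume "(2::'a) = 0"
    then have "CHAR('a) dvd 2"
      using of_nat_eq_0_iff_char_dvd[of 2, where ?'a = 'a] by simp
    moreover have "CHAR('a) \<noteq> 1"
      by simp
    moreover have "d = 1 \<or> d = 2" if "d dvd 2" for d :: nat
      using that dvd_imp_le[of d 2] by (cases "d = 0") auto
    ultimately show False
      using assms(3) by blast
  qed
  then show ?thesis
    by (rule leibniz_algebra.ideal_generated_null_squares[OF assms(1) _ assms(4,5)])
qed

end
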